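(* Let $K$ be a field and let $X$ be a transitive aperiodic subshift over a finite alphabet. If the monomial algebra $A_X$ over $K$ is exhaustively amenable as a right module over itself, then the convolution algebra $K[\mathfrak{G}_X]$ of the groupoid of the action of $\mathbb Z$ on $X$ is exhaustively amenable as a right module over itself. If, moreover, $X$ is a minimal subshift, then every non-zero right $K[\mathfrak{G}_X]$-module is exhaustively amenable.
   Context: Algebras are associative and unital. Let $\Sigma=\{x_1,\dots,x_d\}$ be a finite alphabet. A subshift $X\subseteq\Sigma^{\mathbb Z}$ is a non-empty closed, shift-invariant subset (product topology, $\Sigma$ discrete); $T$ denotes the shift on $X$. $X$ is transitive if it has a dense shift-orbit, minimal if it contains no non-empty proper subshift; a transitive subshift is aperiodic if it is not the orbit of a periodic sequence (equivalently, $X$ is infinite). A factor of $X$ is a finite word occurring as a contiguous subword of some element of $X$. The monomial algebra $A_X$ over $K$ has as basis the finite factors of $X$ (including the empty word $1$), with multiplication given by concatenation, where a product of factors is set to be $0$ if the concatenated word is not a factor of $X$. The groupoid $\mathfrak{G}_X$ of the action $\mathbb Z\curvearrowright X$ has underlying space $\mathbb Z\times X$ (product topology, $\mathbb Z$ discrete) with partial multiplication $(m_2,T^{m_1}(x))\cdot(m_1,x)=(m_1+m_2,x)$. The convolution algebra $K[\mathfrak{G}_X]$ consists of all continuous, compactly supported functions $f\colon\mathfrak{G}_X\to K$ ($K$ with the discrete topology), with product $(f_1\cdot f_2)(g)=\sum_h f_1(h)f_2(h^{-1}g)$, the sum being over those $h\in\mathfrak{G}_X$ for which $h^{-1}g$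 is defined. Let $A$ be a $K$-algebra and $M$ a right $A$-module. For a finite-dimensional subspace $V\leq A$ and $\varepsilon>0$, a finite-dimensional subspace $L\leq M$ is $(V,\varepsilon)$-invariant if $\dim_K LV<(1+\varepsilon)\dim_K L$, where $LV$ is the span of all products $\ell v$, $\ell\in L$, $v\in V$. The module $M$ is exhaustively amenable if for every finite-dimensional $V\leq A$, every $\varepsilon>0$ and every finite-dimensional $W\leq M$ there is a $(V,\varepsilon)$-invariant subspace of $M$ containing $W$. *)

theory Defs
  imports "HOL-Analysis.Function_Topology" "HOL-Analysis.Product_Topology"
    "HOL-Library.Function_Algebras"
begin

section \<open>Algebras, right modules and exhaustive amenability\<close>

text \<open>
  Algebras and modules over a field live on a subspace (\<open>A\<close>, \<open>M\<close>) of an ambient vector space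
  that is a whole type, so that \<open>span\<close> and \<open>dim\<close> are those of \<^locale>\<open>vector_space\<close>.
\<close>

locale K_algebra = vector_space scale
  for scale :: "'k::field \<Rightarrow> 'b::ab_group_add \<Rightarrow> 'b" +
  fixes A :: "'b set" and mult :: "'b \<Rightarrow> 'b \<Rightarrow> 'b" and one :: 'b
  assumes subspace_carrier: "subspace A"
    and one_closed: "one \<in> A"
    and mult_closed: "\<lbrakk>a \<in> A; b \<in> A\<rbrakk> \<Longrightarrow> mult a b \<in> A"
    and mult_assoc: "\<lbrakk>a \<in> A; b \<in> A; c \<in> A\<rbrakk> \<Longrightarrow> mult (mult a b) c = mult a (mult b c)"
    and mult_one_left: "a \<in> A \<Longrightarrow> mult one a = a"
    and mult_one_right: "a \<in> A \<Longrightarrow> mult a one = a"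
    and mult_add_left: "\<lbrakk>a \<in> A; b \<in> A; c \<in> A\<rbrakk> \<Longrightarrow> mult (a + b) c = mult a c + mult b c"
    and mult_add_right: "\<lbrakk>a \<in> A; b \<in> A; c \<in> A\<rbrakk> \<Longrightarrow> mult a (b + c) = mult a b + mult a c"
    and mult_scale_left: "\<lbrakk>a \<in> A; b \<in> A\<rbrakk> \<Longrightarrow> mult (scale r a) b = scale r (mult a b)"
    and mult_scale_right: "\<lbrakk>a \<in> A; b \<in> A\<rbrakk> \<Longrightarrow> mult a (scale r b) = scale r (mult a b)"

locale right_module =
  A: K_algebra scaleA A mult one + M: vector_space scaleM
  for scaleA :: "'k::field \<Rightarrow> 'b::ab_group_add \<Rightarrow> 'b" and A mult one
    and scaleM :: "'k \<Rightarrow> 'm::ab_group_add \<Rightarrow> 'm" +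
  fixes M :: "'m set" and act :: "'m \<Rightarrow> 'b \<Rightarrow> 'm"
  assumes subspace_module: "M.subspace M"
    and act_closed: "\<lbrakk>m \<in> M; a \<in> A\<rbrakk> \<Longrightarrow> act m a \<in> M"
    and act_one: "m \<in> M \<Longrightarrow> act m one = m"
    and act_mult: "\<lbrakk>m \<in> M; a \<in> A; b \<in> A\<rbrakk> \<Longrightarrow> act m (mult a b) = act (act m a) b"
    and act_add_left: "\<lbrakk>m \<in> M; n \<in> M; a \<in> A\<rbrakk> \<Longrightarrow> act (m + n) a = act m a + act n a"
    and act_add_right: "\<lbrakk>m \<in> M; a \<in> A; b \<in> A\<rbrakk> \<Longrightarrow> act m (a + b) = act m a + act m b"
    and act_scale_left: "\<lbrakk>m \<in> M; a \<in> A\<rbrakk> \<Longrightarrow> act (scaleM r m) a = scaleM r (act m a)"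
    and act_scale_right: "\<lbrakk>m \<in> M; a \<in> A\<rbrakk> \<Longrightarrow> act m (scaleA r a) = scaleM r (act m a)"

lemma (in K_algebra) right_module_self: "right_module scale A mult one scale A mult"
  by unfold_locales
    (simp_all add: subspace_carrier one_closed mult_closed mult_assoc mult_one_left mult_one_right
      mult_add_left mult_add_right mult_scale_left mult_scale_right)

definition fin_dim_subspace :: "('k::field \<Rightarrow> 'v::ab_group_add \<Rightarrow> 'v) \<Rightarrow> 'v set \<Rightarrow> bool" where
  "fin_dim_subspace s V \<longleftrightarrow> (\<exists>B. finite B \<and> V = module.span s B)"

text \<open>The space \<open>LV\<close>.\<close>

definition span_products ::
  "('k::field \<Rightarrow> 'm::ab_group_add \<Rightarrow> 'm) \<Rightarrow> ('m \<Rightarrow> 'b \<Rightarrow> 'm) \<Rightarrow> 'm set \<Rightarrow> 'b set \<Rightarrow> 'm set" where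
  "span_products s act L V = module.span s {act l v |l v. l \<in> L \<and> v \<in> V}"

definition invariant_subspace ::
  "('k::field \<Rightarrow> 'm::ab_group_add \<Rightarrow> 'm) \<Rightarrow> 'm set \<Rightarrow> ('m \<Rightarrow> 'b \<Rightarrow> 'm) \<Rightarrow> 'b set \<Rightarrow> real \<Rightarrow> 'm set \<Rightarrow> bool"
  where
  "invariant_subspace s M act V \<epsilon> L \<longleftrightarrow>
    fin_dim_subspace s L \<and> L \<subseteq> M \<and>
    real (vector_space.dim s (span_products s act L V)) < (1 + \<epsilon>) * real (vector_space.dim s L)"

definition exhaustively_amenable ::
  "('k::field \<Rightarrow> 'b::ab_group_add \<Rightarrow> 'b) \<Rightarrow> 'b set \<Rightarrow>
   ('k \<Rightarrow> 'm::ab_group_add \<Rightarrow> 'm) \<Rightarrow> 'm set \<Rightarrow> ('m \<Rightarrow> 'b \<Rightarrow> 'm) \<Rightarrow> bool" where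
  "exhaustively_amenable sA A sM M act \<longleftrightarrow>
    (\<forall>V \<epsilon> W. fin_dim_subspace sA V \<and> V \<subseteq> A \<and> 0 < \<epsilon> \<and> fin_dim_subspace sM W \<and> W \<subseteq> M \<longrightarrow>
      (\<exists>L. invariant_subspace sM M act V \<epsilon> L \<and> W \<subseteq> L))"

text \<open>The pointwise vector space structure on functions into a field.\<close>

definition fun_scale :: "'k::field \<Rightarrow> ('i \<Rightarrow> 'k) \<Rightarrow> 'i \<Rightarrow> 'k" where
  "fun_scale c f = (\<lambda>i. c * f i)"

lemma vector_space_fun_scale: "vector_space fun_scale"
  by unfold_locales (auto simp: fun_scale_def fun_eq_iff algebra_simps)


section \<open>Subshifts\<close>

definition shift :: "int \<Rightarrow> (int \<Rightarrow> 'a) \<Rightarrow> (int \<Rightarrow> 'a)" where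
  "shift n x = (\<lambda>i. x (i + n))"

lemma shift_0 [simp]: "shift 0 x = x"
  by (simp add: shift_def)

lemma shift_shift [simp]: "shift m (shift n x) = shift (m + n) x"
  by (simp add: shift_def algebra_simps)

definition sequence_topology :: "(int \<Rightarrow> 'a) topology" where
  "sequence_topology = product_topology (\<lambda>_. discrete_topology UNIV) UNIV"

definition subshift :: "(int \<Rightarrow> 'a::finite) set \<Rightarrow> bool" where
  "subshift X \<longleftrightarrow> X \<noteq> {} \<and> closedin sequence_topology X \<and> shift 1 ` X = X"

definition orbit :: "(int \<Rightarrow> 'a) \<Rightarrow> (int \<Rightarrow> 'a) set" where
  "orbit x = range (\<lambda>n. shift n x)"

definition transitive_subshift :: "(int \<Rightarrow> 'a::finite) set \<Rightarrow> bool" where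
  "transitive_subshift X \<longleftrightarrow>
    subshift X \<and> (\<exists>x\<in>X. subtopology sequence_topology X closure_of orbit x = X)"

definition minimal_subshift :: "(int \<Rightarrow> 'a::finite) set \<Rightarrow> bool" where
  "minimal_subshift X \<longleftrightarrow> subshift X \<and> \<not> (\<exists>Y. subshift Y \<and> Y \<subset> X)"

definition periodic :: "(int \<Rightarrow> 'a) \<Rightarrow> bool" where
  "periodic x \<longleftrightarrow> (\<exists>p>0. shift p x = x)"

definition aperiodic_subshift :: "(int \<Rightarrow> 'a::finite) set \<Rightarrow> bool" where
  "aperiodic_subshift X \<longleftrightarrow> \<not> (\<exists>x. periodic x \<and> X = orbit x)"

definition factors :: "(int \<Rightarrow> 'a) set \<Rightarrow> 'a list set" where
  "factors X = {w. \<exists>x\<in>X. \<exists>i. \<forall>j<length w. w ! j = x (i + int j)}"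


section \<open>The monomial algebra\<close>

text \<open>
  A linear combination of factors is encoded as the finitely supported function of its
  coefficients.
\<close>

definition monomial_algebra :: "(int \<Rightarrow> 'a) set \<Rightarrow> ('a list \<Rightarrow> 'k::field) set" where
  "monomial_algebra X = {f. finite {w. f w \<noteq> 0} \<and> {w. f w \<noteq> 0} \<subseteq> factors X}"

definition monomial_mult ::
  "(int \<Rightarrow> 'a) set \<Rightarrow> ('a list \<Rightarrow> 'k::field) \<Rightarrow> ('a list \<Rightarrow> 'k) \<Rightarrow> 'a list \<Rightarrow> 'k" where
  "monomial_mult X f g =
    (\<lambda>w. if w \<in> factors X then \<Sum>(u, v)\<in>{(u, v). u @ v = w}. f u * g v else 0)"

definition monomial :: "'a list \<Rightarrow> 'a list \<Rightarrow> 'k::field" where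
  "monomial u = (\<lambda>w. if w = u then 1 else 0)"

lemma finite_splits: "finite {(u, v). u @ v = w}"
proof -
  have "p \<in> (\<lambda>n. (take n w, drop n w)) ` {..length w}" if "fst p @ snd p = w" for p
    using that by (intro image_eqI[where x = "length (fst p)"]) auto
  then have "{(u, v). u @ v = w} \<subseteq> (\<lambda>n. (take n w, drop n w)) ` {..length w}"
    by fastforce
  then show ?thesis
    by (rule finite_subset) simp
qed

lemma monomial_mult_monomial:
  "monomial_mult X (monomial u) (monomial v) =
    (if u @ v \<in> factors X then monomial (u @ v) else (0 :: 'a list \<Rightarrow> 'k::field))"
proof
  fix w :: "'a list"
  have "(\<Sum>(u', v')\<in>{(u', v'). u' @ v' = w}. monomial u u' * (monomial v v' :: 'k)) =
      (\<Sum>p\<in>{(u', v'). u' @ v' = w}. if p = (u, v) then 1 else 0)"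
    by (rule sum.cong) (auto simp: monomial_def split: if_splits)
  also have "\<dots> = (if u @ v = w then 1 else 0)"
    by (simp add: finite_splits)
  finally show "monomial_mult X (monomial u) (monomial v) w =
      (if u @ v \<in> factors X then monomial (u @ v) else (0 :: 'a list \<Rightarrow> 'k)) w"
    by (auto simp: monomial_mult_def monomial_def)
qed


section \<open>The groupoid and its convolution algebra\<close>

definition groupoid :: "(int \<Rightarrow> 'a) set \<Rightarrow> (int \<times> (int \<Rightarrow> 'a)) set" where
  "groupoid X = UNIV \<times> X"

definition groupoid_topology :: "(int \<Rightarrow> 'a) set \<Rightarrow> (int \<times> (int \<Rightarrow> 'a)) topology" where
  "groupoid_topology X =
    prod_topology (discrete_topology UNIV) (subtopology sequence_topology X)"

definition composable :: "int \<times> (int \<Rightarrow> 'a) \<Rightarrow> int \<times> (int \<Rightarrow> 'a) \<Rightarrow> bool" where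
  "composable g h \<longleftrightarrow> snd g = shift (fst h) (snd h)"

definition gcomp :: "int \<times> (int \<Rightarrow> 'a) \<Rightarrow> int \<times> (int \<Rightarrow> 'a) \<Rightarrow> int \<times> (int \<Rightarrow> 'a)" where
  "gcomp g h = (fst h + fst g, snd h)"

definition ginv :: "int \<times> (int \<Rightarrow> 'a) \<Rightarrow> int \<times> (int \<Rightarrow> 'a)" where
  "ginv g = (- fst g, shift (fst g) (snd g))"

text \<open>Functions on the groupoid are extended by 0 to the whole type.\<close>

definition convolution_algebra ::
  "(int \<Rightarrow> 'a) set \<Rightarrow> (int \<times> (int \<Rightarrow> 'a) \<Rightarrow> 'k::field) set" where
  "convolution_algebra X =
    {f. continuous_map (groupoid_topology X) (discrete_topology UNIV) f \<and>
        compactin (groupoid_topology X)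
          (groupoid_topology X closure_of {g \<in> groupoid X. f g \<noteq> 0}) \<and>
        (\<forall>g. g \<notin> groupoid X \<longrightarrow> f g = 0)}"

text \<open>
  The sum ranges over the \<open>h\<close> for which \<open>h\<^sup>-\<^sup>1g\<close> is defined; infinitely many of them may exist,
  but only finitely many satisfy \<open>f\<^sub>1 h \<noteq> 0\<close> (and the others do not contribute).
\<close>

definition convolution ::
  "(int \<Rightarrow> 'a) set \<Rightarrow> (int \<times> (int \<Rightarrow> 'a) \<Rightarrow> 'k::field) \<Rightarrow> (int \<times> (int \<Rightarrow> 'a) \<Rightarrow> 'k) \<Rightarrow>
    int \<times> (int \<Rightarrow> 'a) \<Rightarrow> 'k" where
  "convolution X f1 f2 =
    (\<lambda>g. if g \<in> groupoid X
         then \<Sum>h\<in>{h \<in> groupoid X. composable (ginv h) g \<and> f1 h \<noteq> 0}. f1 h * f2 (gcomp (ginv h) g)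
         else 0)"

definition convolution_one :: "(int \<Rightarrow> 'a) set \<Rightarrow> int \<times> (int \<Rightarrow> 'a) \<Rightarrow> 'k::field" where
  "convolution_one X = (\<lambda>g. if g \<in> {0} \<times> X then 1 else 0)"


subsection \<open>The convolution algebra is an algebra\<close>

lemma shift_mem:
  assumes "subshift X" "x \<in> X"
  shows "shift n x \<in> X"
proof -
  have eq: "shift 1 ` X = X"
    using assms by (simp add: subshift_def)
  have pos: "shift (int k) y \<in> X" if "y \<in> X" for k y
  proof (induction k)
    case (Suc k)
    then have "shift 1 (shift (int k) y) \<in> X"
      using eq by blast
    then show ?case
      by simp
  qed (simp add: that)
  have neg: "shift (- int k) y \<in> X" if "y \<in> X" for k y
  proof (induction k)
    case (Suc k)
    then obtain z where z: "z \<in> X" "shift (- int k) y = shift 1 z"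
      using eq by blast
    then have "shift (- 1) (shift (- int k) y) = z"
      by simp
    moreover have "shift (- 1) (shift (- int k) y) = shift (- int (Suc k)) y"
      by (simp add: algebra_simps)
    ultimately show ?case
      using z by simp
  qed (simp add: that)
  show ?thesis
    using pos neg assms by (cases n rule: int_cases2) auto
qed

lemma continuous_map_shift: "continuous_map sequence_topology sequence_topology (shift n)"
  unfolding sequence_topology_def shift_def continuous_map_componentwise_UNIV
  by (rule allI continuous_map_product_projection UNIV_I)+

lemma topspace_groupoid_topology [simp]: "topspace (groupoid_topology X) = groupoid X"
  by (simp add: groupoid_topology_def groupoid_def sequence_topology_def)

lemma finite_degrees:
  assumes "f \<in> convolution_algebra X"
  shows "finite {n. \<exists>x\<in>X. f (n, x) \<noteq> 0}"
proof -
  let ?S = "{g \<in> groupoid X. f g \<noteq> 0}"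
  let ?C = "groupoid_topology X closure_of ?S"
  have "continuous_map (groupoid_topology X) (discrete_topology UNIV) fst"
    unfolding groupoid_topology_def by (rule continuous_map_fst)
  moreover have "compactin (groupoid_topology X) ?C"
    using assms unfolding convolution_algebra_def by blast
  ultimately have "compactin (discrete_topology UNIV) (fst ` ?C)"
    by (rule image_compactin[rotated])
  then have "finite (fst ` ?C)"
    by (simp add: compactin_discrete_topology)
  moreover have "?S \<subseteq> ?C"
    by (rule closure_of_subset) auto
  then have "{n. \<exists>x\<in>X. f (n, x) \<noteq> 0} \<subseteq> fst ` ?C"
    by (force simp: groupoid_def)
  ultimately show ?thesis
    using finite_subset by blast
qed

lemma convolution_algebraI:
  assumes X: "subshift X"
    and cont: "\<And>n. continuous_map (subtopology sequence_topology X) (discrete_topology UNIV) (\<lambda>x. f (n, x))"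
    and fin: "finite N" "\<forall>n x. n \<notin> N \<longrightarrow> f (n, x) = 0"
    and out: "\<And>n x. x \<notin> X \<Longrightarrow> f (n, x) = 0"
  shows "f \<in> convolution_algebra X"
proof -
  have "compact_space (product_topology (\<lambda>_::int. discrete_topology (UNIV :: 'a set)) UNIV)"
    by (simp add: compact_space_product_topology compact_space_discrete_topology)
  then have "compactin sequence_topology X"
    using X by (simp add: subshift_def sequence_topology_def closedin_compact_space)
  then have "compactin (subtopology sequence_topology X) X"
    by (simp add: compactin_subtopology)
  then have comp: "compactin (groupoid_topology X) (N \<times> X)"
    by (auto simp: groupoid_topology_def compactin_Times compactin_discrete_topology fin)
  have "X = topspace (subtopology sequence_topology X)"
    by (simp add: sequence_topology_def)
  then have "closedin (subtopology sequence_topology X) X"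
    by (metis closedin_topspace)
  then have "closedin (groupoid_topology X) (N \<times> X)"
    by (simp add: groupoid_topology_def closedin_prod_Times_iff)
  moreover have "{g \<in> groupoid X. f g \<noteq> 0} \<subseteq> N \<times> X"
    using fin by (auto simp: groupoid_def)
  ultimately have "groupoid_topology X closure_of {g \<in> groupoid X. f g \<noteq> 0} \<subseteq> N \<times> X"
    by (rule closure_of_minimal[rotated])
  then have 1: "compactin (groupoid_topology X)
      (groupoid_topology X closure_of {g \<in> groupoid X. f g \<noteq> 0})"
    by (rule closed_compactin[OF comp _ closedin_closure_of])
  have "openin (groupoid_topology X) {g \<in> groupoid X. f g \<in> U}" for U
  proof -
    have "{g \<in> groupoid X. f g \<in> U} = (\<Union>n. {n} \<times> {x \<in> X. f (n, x) \<in> U})"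
      by (auto simp: groupoid_def)
    moreover have "openin (subtopology sequence_topology X) {x \<in> X. f (n, x) \<in> U}" for n
      using cont[of n] by (simp add: continuous_map_def sequence_topology_def)
    then have "openin (groupoid_topology X) ({n} \<times> {x \<in> X. f (n, x) \<in> U})" for n
      by (simp add: groupoid_topology_def openin_prod_Times_iff)
    ultimately show ?thesis
      by (metis (no_types, lifting) openin_Union imageE)
  qed
  then have "continuous_map (groupoid_topology X) (discrete_topology UNIV) f"
    by (simp add: continuous_map_def)
  with 1 out show ?thesis
    by (auto simp: convolution_algebra_def groupoid_def)
qed

lemma convolution_algebra_continuous:
  assumes "f \<in> convolution_algebra X"
  shows "continuous_map (subtopology sequence_topology X) (discrete_topology UNIV) (\<lambda>x. f (n, x))"
proof -
  have "continuous_map (subtopology sequence_topology X) (groupoid_topology X) (\<lambda>x. (n, x))"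
    unfolding groupoid_topology_def by (intro continuous_intros) auto
  moreover have "continuous_map (groupoid_topology X) (discrete_topology UNIV) f"
    using assms by (simp add: convolution_algebra_def)
  ultimately show ?thesis
    using continuous_map_compose[of _ _ "\<lambda>x. (n, x)" _ f] by (simp add: o_def)
qed

lemma convolution_algebra_outside:
  "\<lbrakk>f \<in> convolution_algebra X; x \<notin> X\<rbrakk> \<Longrightarrow> f (n, x) = 0"
  by (simp add: convolution_algebra_def groupoid_def)

lemma continuous_map_discrete_op:
  assumes "continuous_map T (discrete_topology UNIV) f" "continuous_map T (discrete_topology UNIV) g"
  shows "continuous_map T (discrete_topology UNIV) (\<lambda>x. h (f x) (g x))"
proof -
  have "continuous_map T (discrete_topology UNIV) (\<lambda>x. (f x, g x))"
    using continuous_map_pairedI[OF assms] by (simp flip: prod_topology_discrete_topology)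
  then show ?thesis
    using continuous_map_compose[of T "discrete_topology UNIV" "\<lambda>x. (f x, g x)"
        "discrete_topology UNIV" "\<lambda>(a, b). h a b"] by (simp add: o_def)
qed

lemma continuous_map_discrete_sum:
  assumes "\<And>n. n \<in> N \<Longrightarrow> continuous_map T (discrete_topology UNIV) (f n)"
  shows "continuous_map T (discrete_topology UNIV) (\<lambda>x. \<Sum>n\<in>N. f n x :: 'k::comm_monoid_add)"
  using assms
proof (induction N rule: infinite_finite_induct)
  case (insert n N)
  then show ?case
    using continuous_map_discrete_op[of T "f n" "\<lambda>x. \<Sum>n\<in>N. f n x" "(+)"] by simp
qed simp_all

lemma continuous_map_shift_sub:
  assumes "subshift X"
  shows "continuous_map (subtopology sequence_topology X) (subtopology sequence_topology X) (shift n)"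
  by (intro continuous_map_into_subtopology continuous_map_from_subtopology continuous_map_shift)
    (auto simp: assms shift_mem)

lemma convolution_eq_sum:
  assumes X: "subshift X" and x: "x \<in> X"
    and fin: "finite N" and N: "\<forall>n y. n \<notin> N \<longrightarrow> f (n, y) = 0"
  shows "convolution X f g (m, x) = (\<Sum>n\<in>N. f (n, shift (m - n) x) * g (m - n, x))"
proof -
  let ?N = "{n \<in> N. f (n, shift (m - n) x) \<noteq> 0}"
  have shift_eq: "shift n y = shift m x \<longleftrightarrow> y = shift (m - n) x" for n y
  proof
    assume "shift n y = shift m x"
    then have "shift (- n) (shift n y) = shift (- n) (shift m x)"
      by (rule arg_cong)
    then show "y = shift (m - n) x"
      by simp
  qed simp
  have "{h \<in> groupoid X. composable (ginv h) (m, x) \<and> f h \<noteq> 0} =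
      (\<lambda>n. (n, shift (m - n) x)) ` ?N"
    using N by (fastforce simp: groupoid_def composable_def ginv_def shift_eq x X shift_mem image_iff)
  then have "convolution X f g (m, x) =
      (\<Sum>h\<in>(\<lambda>n. (n, shift (m - n) x)) ` ?N. f h * g (gcomp (ginv h) (m, x)))"
    by (simp add: convolution_def groupoid_def x)
  also have "\<dots> = (\<Sum>n\<in>?N. f (n, shift (m - n) x) * g (m - n, x))"
    by (subst sum.reindex) (auto simp: inj_on_def gcomp_def ginv_def)
  also have "\<dots> = (\<Sum>n\<in>N. f (n, shift (m - n) x) * g (m - n, x))"
    by (rule sum.mono_neutral_left) (auto simp: fin)
  finally show ?thesis .
qed

lemma convolution_outside: "x \<notin> X \<Longrightarrow> convolution X f g (m, x) = 0"
  by (simp add: convolution_def groupoid_def)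

lemma finite_degreesE:
  assumes "f \<in> convolution_algebra X"
  obtains N where "finite N" "\<forall>n x. n \<notin> N \<longrightarrow> f (n, x) = 0"
proof
  show "finite {n. \<exists>x\<in>X. f (n, x) \<noteq> 0}"
    using assms by (rule finite_degrees)
  show "\<forall>n x. n \<notin> {n. \<exists>x\<in>X. f (n, x) \<noteq> 0} \<longrightarrow> f (n, x) = 0"
  proof (intro allI impI)
    fix n x assume "n \<notin> {n. \<exists>x\<in>X. f (n, x) \<noteq> 0}"
    then show "f (n, x) = 0"
      by (cases "x \<in> X") (auto simp: convolution_algebra_outside[OF assms])
  qed
qed

lemma convolution_vanishes:
  assumes X: "subshift X"
    and F: "finite F" "\<forall>n x. n \<notin> F \<longrightarrow> f (n, x) = 0"
    and G: "\<forall>n x. n \<notin> G \<longrightarrow> g (n, x) = 0"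
    and n: "n \<notin> (\<lambda>(i, j). i + j) ` (F \<times> G)"
  shows "convolution X f g (n, x) = 0"
proof (cases "x \<in> X")
  case True
  have "n - i \<notin> G" if "i \<in> F" for i
  proof
    assume "n - i \<in> G"
    with that have "n \<in> (\<lambda>(i, j). i + j) ` (F \<times> G)"
      by (intro image_eqI[where x = "(i, n - i)"]) auto
    with n show False
      by contradiction
  qed
  then show ?thesis
    by (simp add: convolution_eq_sum[OF X True F] G)
qed (simp add: convolution_outside)

lemma convolution_closed:
  assumes X: "subshift X" and f: "f \<in> convolution_algebra X" and g: "g \<in> convolution_algebra X"
  shows "convolution X f g \<in> convolution_algebra X"
proof -
  obtain F where F: "finite F" "\<forall>n x. n \<notin> F \<longrightarrow> f (n, x) = 0"
    using finite_degreesE[OF f] .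
  obtain G where G: "finite G" "\<forall>n x. n \<notin> G \<longrightarrow> g (n, x) = 0"
    using finite_degreesE[OF g] .
  show ?thesis
  proof (rule convolution_algebraI[OF X])
    fix m :: int
    have "continuous_map (subtopology sequence_topology X) (discrete_topology UNIV)
        (\<lambda>x. \<Sum>n\<in>F. f (n, shift (m - n) x) * g (m - n, x))"
    proof (intro continuous_map_discrete_sum continuous_map_discrete_op[where h = "(*)"])
      fix n
      show "continuous_map (subtopology sequence_topology X) (discrete_topology UNIV)
          (\<lambda>x. f (n, shift (m - n) x))"
        using continuous_map_compose[OF continuous_map_shift_sub[OF X]
            convolution_algebra_continuous[OF f]] by (simp add: o_def)
    qed (rule convolution_algebra_continuous[OF g])
    then show "continuous_map (subtopology sequence_topology X) (discrete_topology UNIV)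
        (\<lambda>x. convolution X f g (m, x))"
      by (rule continuous_map_eq) (simp add: convolution_eq_sum[OF X _ F])
  next
    show "finite ((\<lambda>(i, j). i + j) ` (F \<times> G))"
      using F G by simp
  qed (simp_all add: convolution_vanishes[OF X F G(2)] convolution_outside)
qed

lemma convolution_assoc:
  assumes X: "subshift X" and f: "f \<in> convolution_algebra X"
    and g: "g \<in> convolution_algebra X" and h: "h \<in> convolution_algebra X"
  shows "convolution X (convolution X f g) h = convolution X f (convolution X g h)"
proof
  fix p :: "int \<times> (int \<Rightarrow> 'a)"
  obtain m x where p: "p = (m, x)"
    by (cases p)
  obtain F where F: "finite F" "\<forall>n x. n \<notin> F \<longrightarrow> f (n, x) = 0"
    using finite_degreesE[OF f] .
  obtain G where G: "finite G" "\<forall>n x. n \<notin> G \<longrightarrow> g (n, x) = 0"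
    using finite_degreesE[OF g] .
  let ?S = "(\<lambda>(i, j). i + j) ` (F \<times> G)"
  let ?t = "\<lambda>k n. f (k, shift (m - k) x) * (g (n - k, shift (m - n) x) * h (m - n, x))"
  show "convolution X (convolution X f g) h p = convolution X f (convolution X g h) p"
  proof (cases "x \<in> X")
    case x: True
    have "convolution X (convolution X f g) h (m, x) =
        (\<Sum>n\<in>?S. convolution X f g (n, shift (m - n) x) * h (m - n, x))"
      using F G by (intro convolution_eq_sum X x) (auto intro: convolution_vanishes[OF X F G(2)])
    also have "\<dots> = (\<Sum>n\<in>?S. \<Sum>k\<in>F. ?t k n)"
      by (simp add: convolution_eq_sum[OF X shift_mem[OF X x] F] sum_distrib_right mult.assoc)
    also have "\<dots> = (\<Sum>k\<in>F. \<Sum>n\<in>?S. ?t k n)"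
      by (rule sum.swap)
    also have "\<dots> = (\<Sum>k\<in>F. \<Sum>j\<in>G. ?t k (k + j))"
    proof (rule sum.cong[OF refl])
      fix k assume k: "k \<in> F"
      have "(\<Sum>n\<in>?S. ?t k n) = (\<Sum>n\<in>(+) k ` G. ?t k n)"
      proof (rule sum.mono_neutral_right)
        show "\<forall>n\<in>?S - (+) k ` G. ?t k n = 0"
        proof
          fix n assume "n \<in> ?S - (+) k ` G"
          then have "n - k \<notin> G"
            by (force simp: image_iff)
          then show "?t k n = 0"
            by (simp add: G)
        qed
      qed (use k F G in auto)
      also have "\<dots> = (\<Sum>j\<in>G. ?t k (k + j))"
        by (subst sum.reindex) (auto simp: o_def)
      finally show "(\<Sum>n\<in>?S. ?t k n) = (\<Sum>j\<in>G. ?t k (k + j))" .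
    qed
    also have "\<dots> = (\<Sum>k\<in>F. f (k, shift (m - k) x) * convolution X g h (m - k, x))"
      by (simp add: convolution_eq_sum[OF X x G] sum_distrib_left diff_diff_add)
    also have "\<dots> = convolution X f (convolution X g h) (m, x)"
      by (simp add: convolution_eq_sum[OF X x F])
    finally show ?thesis
      by (simp add: p)
  qed (simp add: p convolution_outside)
qed

lemma subspace_convolution_algebra:
  assumes X: "subshift X"
  shows "module.subspace fun_scale (convolution_algebra X)"
proof -
  interpret vector_space "fun_scale :: 'b \<Rightarrow> (int \<times> (int \<Rightarrow> 'a) \<Rightarrow> 'b) \<Rightarrow> _"
    by (rule vector_space_fun_scale)
  show ?thesis
  proof (rule subspaceI)
    show "0 \<in> convolution_algebra X"
      by (rule convolution_algebraI[OF X, where N = "{}"]) (auto simp: zero_fun_def)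
  next
    fix f g :: "int \<times> (int \<Rightarrow> 'a) \<Rightarrow> 'b"
    assume f: "f \<in> convolution_algebra X" and g: "g \<in> convolution_algebra X"
    obtain F where F: "finite F" "\<forall>n x. n \<notin> F \<longrightarrow> f (n, x) = 0"
      using finite_degreesE[OF f] .
    obtain G where G: "finite G" "\<forall>n x. n \<notin> G \<longrightarrow> g (n, x) = 0"
      using finite_degreesE[OF g] .
    show "f + g \<in> convolution_algebra X"
      using F G convolution_algebra_outside[OF f] convolution_algebra_outside[OF g]
      by (intro convolution_algebraI[OF X, where N = "F \<union> G"])
        (auto simp: plus_fun_def intro: continuous_map_discrete_op[where h = "(+)"]
          convolution_algebra_continuous[OF f] convolution_algebra_continuous[OF g])
  next
    fix c :: 'b and f :: "int \<times> (int \<Rightarrow> 'a) \<Rightarrow> 'b"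
    assume f: "f \<in> convolution_algebra X"
    obtain F where F: "finite F" "\<forall>n x. n \<notin> F \<longrightarrow> f (n, x) = 0"
      using finite_degreesE[OF f] .
    show "fun_scale c f \<in> convolution_algebra X"
      using F convolution_algebra_outside[OF f]
      by (intro convolution_algebraI[OF X, where N = F])
        (auto simp: fun_scale_def intro: continuous_map_discrete_op[where h = "(*)"]
          convolution_algebra_continuous[OF f])
  qed
qed

lemma K_algebra_convolution_algebra:
  assumes X: "subshift X"
  shows "K_algebra fun_scale (convolution_algebra X :: (int \<times> (int \<Rightarrow> 'a::finite) \<Rightarrow> 'k::field) set)
    (convolution X) (convolution_one X)"
proof -
  interpret vector_space "fun_scale :: 'k \<Rightarrow> (int \<times> (int \<Rightarrow> 'a) \<Rightarrow> 'k) \<Rightarrow> _"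
    by (rule vector_space_fun_scale)
  have sub: "subspace (convolution_algebra X :: (int \<times> (int \<Rightarrow> 'a) \<Rightarrow> 'k) set)"
    using subspace_convolution_algebra[OF X] .
  have one: "(convolution_one X :: int \<times> (int \<Rightarrow> 'a) \<Rightarrow> 'k) \<in> convolution_algebra X"
  proof (rule convolution_algebraI[OF X, where N = "{0}"])
    fix n :: int
    have "continuous_map (subtopology sequence_topology X) (discrete_topology UNIV)
        (\<lambda>x. if n = 0 then 1 else 0 :: 'k)"
      by simp
    then show "continuous_map (subtopology sequence_topology X) (discrete_topology UNIV)
        (\<lambda>x. convolution_one X (n, x) :: 'k)"
      by (rule continuous_map_eq) (simp add: convolution_one_def)
  qed (auto simp: convolution_one_def)
  show ?thesis
  proof unfold_locales
    fix a b c :: "int \<times> (int \<Rightarrow> 'a) \<Rightarrow> 'k" and r :: 'k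
    assume a: "a \<in> convolution_algebra X"
    obtain A where A: "finite A" "\<forall>n x. n \<notin> A \<longrightarrow> a (n, x) = 0"
      using finite_degreesE[OF a] .
    show "convolution X (convolution_one X) a = a"
    proof
      fix p :: "int \<times> (int \<Rightarrow> 'a)"
      obtain m x where p: "p = (m, x)"
        by (cases p)
      show "convolution X (convolution_one X) a p = a p"
      proof (cases "x \<in> X")
        case True
        have "convolution X (convolution_one X) a (m, x) =
            (\<Sum>n\<in>{0}. convolution_one X (n, shift (m - n) x) * a (m - n, x))"
          by (rule convolution_eq_sum[OF X True]) (auto simp: convolution_one_def)
        then show ?thesis
          by (simp add: p convolution_one_def shift_mem[OF X True])
      qed (simp add: p convolution_outside convolution_algebra_outside[OF a])
    qed
    show "convolution X a (convolution_one X) = a"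
    proof
      fix p :: "int \<times> (int \<Rightarrow> 'a)"
      obtain m x where p: "p = (m, x)"
        by (cases p)
      show "convolution X a (convolution_one X) p = a p"
      proof (cases "x \<in> X")
        case True
        have "convolution X a (convolution_one X) (m, x) =
            (\<Sum>n\<in>A. if n = m then a (m, x) else 0)"
          by (auto simp: convolution_eq_sum[OF X True A] convolution_one_def True intro!: sum.cong)
        also have "\<dots> = a (m, x)"
          using A by auto
        finally show ?thesis
          by (simp add: p)
      qed (simp add: p convolution_outside convolution_algebra_outside[OF a])
    qed
    assume b: "b \<in> convolution_algebra X"
    obtain B where B: "finite B" "\<forall>n x. n \<notin> B \<longrightarrow> b (n, x) = 0"
      using finite_degreesE[OF b] .
    show "convolution X a b \<in> convolution_algebra X"
      using convolution_closed[OF X a b] .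
    show "convolution X (fun_scale r a) b = fun_scale r (convolution X a b)"
    proof
      fix p :: "int \<times> (int \<Rightarrow> 'a)"
      obtain m x where p: "p = (m, x)"
        by (cases p)
      show "convolution X (fun_scale r a) b p = fun_scale r (convolution X a b) p"
      proof (cases "x \<in> X")
        case True
        have "convolution X (fun_scale r a) b (m, x) =
            (\<Sum>n\<in>A. fun_scale r a (n, shift (m - n) x) * b (m - n, x))"
          by (rule convolution_eq_sum[OF X True A(1)]) (simp add: fun_scale_def A)
        then show ?thesis
          by (simp add: p fun_scale_def convolution_eq_sum[OF X True A] sum_distrib_left mult.assoc)
      qed (simp add: p fun_scale_def convolution_outside)
    qed
    show "convolution X a (fun_scale r b) = fun_scale r (convolution X a b)"
    proof
      fix p :: "int \<times> (int \<Rightarrow> 'a)"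
      show "convolution X a (fun_scale r b) p = fun_scale r (convolution X a b) p"
        by (simp add: convolution_def fun_scale_def sum_distrib_left mult.left_commute)
    qed
    assume c: "c \<in> convolution_algebra X"
    show "convolution X (convolution X a b) c = convolution X a (convolution X b c)"
      using convolution_assoc[OF X a b c] .
    show "convolution X a (b + c) = convolution X a b + convolution X a c"
      by (auto simp: convolution_def fun_eq_iff sum.distrib distrib_left)
    show "convolution X (a + b) c = convolution X a c + convolution X b c"
    proof
      fix p :: "int \<times> (int \<Rightarrow> 'a)"
      obtain m x where p: "p = (m, x)"
        by (cases p)
      show "convolution X (a + b) c p = (convolution X a c + convolution X b c) p"
      proof (cases "x \<in> X")
        case True
        have "finite (A \<union> B)"
          using A B by simp
        then show ?thesis
          using A B
          by (simp add: p convolution_eq_sum[OF X True, where N = "A \<union> B"] sum.distrib distrib_right)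
      qed (simp add: p convolution_outside)
    qed
  qed (fact sub one)+
qed

end

theory Submission
  imports Defs "HOL-Analysis.T1_Spaces"
begin

text \<open>
  Write \<open>T\<^sup>n 1\<^sub>D\<close> for the indicator function of \<open>{n} \<times> D\<close>, where \<open>D\<close> is clopen in \<open>X\<close>; these functions
  span \<open>K[G\<^sub>X]\<close> and multiply as in the crossed product of the locally constant functions by \<open>\<int>\<close>.
  The idea is that a long Rokhlin tower over a small cylinder provides an almost invariant
  subspace in every module on which the indicator function of that cylinder does not act as zero.

  Let \<open>x \<in> X\<close> be a non-periodic point, \<open>C\<close> a small cylinder around it, \<open>M\<close> a right module, and
  \<open>u \<in> M\<close> with \<open>u 1\<^sub>C \<noteq> 0\<close>. Put \<open>b\<^sub>i = u 1\<^sub>C T\<^sup>i\<close>. As \<open>x\<close> is not periodic, the first \<open>n\<close>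
  translates of \<open>C\<close> are disjoint once \<open>C\<close> is small enough; their indicator functions separate
  \<open>b\<^sub>0, \<dots>, b\<^bsub>n-1\<^esub>\<close>, which are therefore linearly independent. Let \<open>V\<close> be spanned by finitely many
  functions, all of them supported in degrees between \<open>-r\<close> and \<open>r\<close>. These functions are locally
  constant, so when \<open>C\<close> is small they are constant on the pieces of the groupoid that matter for the
  tower, and \<open>b\<^sub>i v\<close> is a linear combination of \<open>b\<^bsub>i-r\<^esub>, \<dots>, b\<^bsub>i+r\<^esub>\<close>
  (\<open>tower_level_convolution\<close>). So a space of dimension \<open>n\<close> is moved by \<open>V\<close> into one of dimension at
  most \<open>n + 2r\<close>, where \<open>r\<close> depends on \<open>V\<close> alone. Adding a prescribed finite-dimensional space \<open>W\<close>
  costs at most \<open>dim W \<cdot> dim V\<close> further dimensions, and \<open>n\<close> is arbitrarily large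
  (\<open>exhaustively_amenable_towers\<close>). This yields \<open>exhaustively_amenable_of_cylinders\<close>.

  A transitive aperiodic subshift has a non-periodic point: a point with dense orbit. On the regular
  module, \<open>u = 1\<close> satisfies \<open>u 1\<^sub>C = 1\<^sub>C \<noteq> 0\<close>. If \<open>X\<close> is minimal, then finitely many translates of
  \<open>C\<close> cover \<open>X\<close>, so the two-sided ideal generated by \<open>1\<^sub>C\<close> contains \<open>1\<close>, and \<open>1\<^sub>C\<close> acts as zero on
  the zero module only (\<open>minimal_cylinder_acts_nonzero\<close>).
\<close>

section \<open>A tower criterion for exhaustive amenability\<close>

lemma (in vector_space) card_independent_le_dim_span:
  assumes "independent S" "S \<subseteq> span T" "finite T"
  shows "card S \<le> dim (span T)"
proof -
  obtain B where B: "S \<subseteq> B" "B \<subseteq> span T" "independent B" "span T \<subseteq> span B"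
    using maximal_independent_subset_extend[OF assms(2,1)] by blast
  have "finite B"
    using independent_span_bound[OF assms(3) B(3,2)] by simp
  moreover have "dim (span T) = card B"
    using B by (intro dim_unique) auto
  ultimately show ?thesis
    using B(1) by (simp add: card_mono)
qed

context right_module
begin

lemma zero_act: "a \<in> A \<Longrightarrow> act 0 a = 0"
  using act_scale_left[of 0 a 0] M.subspace_0[OF subspace_module] by simp

lemma act_zero: "m \<in> M \<Longrightarrow> act m 0 = 0"
  using act_scale_right[of m 0 0] A.subspace_0[OF A.subspace_carrier] by simp

lemma subspace_act_left_preimage:
  assumes "M.subspace Z" "a \<in> A"
  shows "M.subspace {m \<in> M. act m a \<in> Z}"
  using assms subspace_module
  by (auto simp: M.subspace_def zero_act act_add_left act_scale_left)

lemma subspace_act_right_preimage: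
  assumes "M.subspace Z" "m \<in> M"
  shows "A.subspace {a \<in> A. act m a \<in> Z}"
  using assms A.subspace_carrier
  by (auto simp: M.subspace_def A.subspace_def act_zero act_add_right act_scale_right)

lemma act_span_subset:
  assumes Z: "M.subspace Z" and S: "S \<subseteq> M" and T: "T \<subseteq> A"
    and ST: "\<And>s t. s \<in> S \<Longrightarrow> t \<in> T \<Longrightarrow> act s t \<in> Z"
    and l: "l \<in> M.span S" and v: "v \<in> A.span T"
  shows "act l v \<in> Z"
proof -
  have T': "A.span T \<subseteq> A"
    using T by (rule A.span_minimal) (rule A.subspace_carrier)
  have "A.span T \<subseteq> {a \<in> A. act s a \<in> Z}" if "s \<in> S" for s
    using that S T ST by (intro A.span_minimal subspace_act_right_preimage Z) auto
  then have "M.span S \<subseteq> {m \<in> M. act m v \<in> Z}"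
    using S T' v by (intro M.span_minimal subspace_act_left_preimage Z) auto
  then show ?thesis
    using l by auto
qed

text \<open>
  The defect \<open>q\<close> is fixed before the size \<open>n\<close> of the almost invariant family is chosen; hence not only
  \<open>q\<close> itself but also the products of the generators of \<open>W\<close> and \<open>V\<close> become negligible for large \<open>n\<close>,
  and any \<open>W\<close> can be adjoined.
\<close>

lemma exhaustively_amenable_towers:
  assumes towers: "\<And>B. finite B \<Longrightarrow> B \<subseteq> A \<Longrightarrow> \<exists>q. \<forall>n. \<exists>S P. S \<subseteq> M \<and> finite S \<and> M.independent S \<and>
      n \<le> card S \<and> finite P \<and> card P \<le> card S + q \<and> (\<forall>s\<in>S. \<forall>v\<in>B. act s v \<in> M.span P)"
  shows "exhaustively_amenable scaleA A scaleM M act"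
  unfolding exhaustively_amenable_def
proof (intro allI impI, elim conjE)
  fix V \<epsilon> W
  assume V: "fin_dim_subspace scaleA V" "V \<subseteq> A" and \<epsilon>: "0 < (\<epsilon>::real)"
    and W: "fin_dim_subspace scaleM W" "W \<subseteq> M"
  obtain B where B: "finite B" "V = A.span B"
    using V(1) by (auto simp: fin_dim_subspace_def)
  obtain C where C: "finite C" "W = M.span C"
    using W(1) by (auto simp: fin_dim_subspace_def)
  have BA: "B \<subseteq> A" and CM: "C \<subseteq> M"
    using V(2) W(2) B(2) C(2) A.span_superset[of B] M.span_superset[of C] by auto
  obtain q where q: "\<And>n. \<exists>S P. S \<subseteq> M \<and> finite S \<and> M.independent S \<and>
      n \<le> card S \<and> finite P \<and> card P \<le> card S + q \<and> (\<forall>s\<in>S. \<forall>v\<in>B. act s v \<in> M.span P)"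
    using towers[OF B(1) BA] by blast
  let ?CB = "(\<lambda>(c, v). act c v) ` (C \<times> B)"
  define d where "d = q + card ?CB"
  obtain n where n: "real d / \<epsilon> < real n"
    using reals_Archimedean2 by blast
  obtain S P where S: "S \<subseteq> M" "finite S" "M.independent S" "n \<le> card S"
    and P: "finite P" "card P \<le> card S + q" "\<forall>s\<in>S. \<forall>v\<in>B. act s v \<in> M.span P"
    using q[of n] by blast
  let ?L = "M.span (S \<union> C)"
  let ?Z = "M.span (P \<union> ?CB)"
  have "act l v \<in> ?Z" if "l \<in> ?L" "v \<in> V" for l v
  proof (rule act_span_subset)
    show "act s t \<in> ?Z" if "s \<in> S \<union> C" "t \<in> B" for s t
    proof (cases "s \<in> S")
      case True
      then show ?thesis
        using that P(3) M.span_mono[of P "P \<union> ?CB"] by auto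
    next
      case False
      then show ?thesis
        using that by (intro M.span_base) auto
    qed
  qed (use that S CM BA B in auto)
  then have "span_products scaleM act ?L V \<subseteq> ?Z"
    unfolding span_products_def by (intro M.span_minimal) auto
  then have "M.dim (span_products scaleM act ?L V) \<le> card (P \<union> ?CB)"
    using P B C by (intro M.dim_le_card) auto
  also have "\<dots> \<le> card P + card ?CB"
    by (rule card_Un_le)
  also have "\<dots> \<le> card S + d"
    using P(2) by (simp add: d_def)
  finally have up: "M.dim (span_products scaleM act ?L V) \<le> card S + d" .
  have low: "card S \<le> M.dim ?L"
    using S C M.span_superset[of "S \<union> C"] by (intro M.card_independent_le_dim_span) auto
  have "real d < \<epsilon> * real n"
    using n \<epsilon> by (simp add: field_simps)
  also have "\<dots> \<le> \<epsilon> * real (M.dim ?L)"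
    using \<epsilon> S(4) low by simp
  finally have "real (M.dim (span_products scaleM act ?L V)) < (1 + \<epsilon>) * real (M.dim ?L)"
    using up low by (simp add: algebra_simps)
  moreover have "?L \<subseteq> M"
    using S CM by (intro M.span_minimal subspace_module) auto
  moreover have "W \<subseteq> ?L"
    unfolding C by (rule M.span_mono) simp
  moreover have "fin_dim_subspace scaleM ?L"
    using S C by (auto simp: fin_dim_subspace_def)
  ultimately show "\<exists>L. invariant_subspace scaleM M act V \<epsilon> L \<and> W \<subseteq> L"
    by (auto simp: invariant_subspace_def)
qed

text \<open>
  The elements that \<open>p i\<close> annihilates form a subspace; it contains the span of all \<open>b j\<close> with
  \<open>j \<noteq> i\<close>, but not \<open>b i\<close>.
\<close>

lemma independent_of_separation:
  assumes b: "\<And>i. i \<in> I \<Longrightarrow> b i \<in> M" and p: "\<And>i. i \<in> I \<Longrightarrow> p i \<in> A"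
    and nz: "\<And>i. i \<in> I \<Longrightarrow> act (b i) (p i) \<noteq> 0"
    and z: "\<And>i j. i \<in> I \<Longrightarrow> j \<in> I \<Longrightarrow> i \<noteq> j \<Longrightarrow> act (b i) (p j) = 0"
  shows "inj_on b I" "M.independent (b ` I)"
proof -
  show "inj_on b I"
    using nz z by (metis inj_onI)
  show "M.independent (b ` I)"
  proof
    assume "M.dependent (b ` I)"
    then obtain i where i: "i \<in> I" "b i \<in> M.span (b ` I - {b i})"
      by (auto simp: M.dependent_def)
    have "M.span (b ` I - {b i}) \<subseteq> {m \<in> M. act m (p i) \<in> {0}}"
      using i b p z by (intro M.span_minimal subspace_act_left_preimage) auto
    with i nz show False
      by auto
  qed
qed

end


section \<open>Cylinders\<close>

definition cylinder :: "(int \<Rightarrow> 'a) set \<Rightarrow> (int \<Rightarrow> 'a) \<Rightarrow> nat \<Rightarrow> (int \<Rightarrow> 'a) set" where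
  "cylinder X x R = {y \<in> X. \<forall>i\<in>{- int R..int R}. y i = x i}"

text \<open>
  Continuity of the membership predicate is what the convolution algebra asks of an indicator
  function, and it is preserved by every Boolean operation.
\<close>

definition clopen_in :: "(int \<Rightarrow> 'a) set \<Rightarrow> (int \<Rightarrow> 'a) set \<Rightarrow> bool" where
  "clopen_in X D \<longleftrightarrow> D \<subseteq> X \<and>
    continuous_map (subtopology sequence_topology X) (discrete_topology UNIV) (\<lambda>y. y \<in> D)"

lemma topspace_sequence_topology [simp]: "topspace sequence_topology = UNIV"
  by (simp add: sequence_topology_def)

lemma clopen_in_openin: "clopen_in X D \<Longrightarrow> openin (subtopology sequence_topology X) D"
proof -
  assume D: "clopen_in X D"
  then have "openin (subtopology sequence_topology X) {y \<in> X. (y \<in> D) \<in> {True}}"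
    by (simp add: clopen_in_def continuous_map_def del: insert_iff singleton_iff)
  moreover have "{y \<in> X. (y \<in> D) \<in> {True}} = D"
    using D by (auto simp: clopen_in_def)
  ultimately show ?thesis
    by simp
qed

lemma clopen_in_space: "clopen_in X X"
proof -
  have "continuous_map (subtopology sequence_topology X) (discrete_topology UNIV) (\<lambda>y. y \<in> X)"
    by (rule continuous_map_eq[where f = "\<lambda>_. True"]) auto
  then show ?thesis
    by (simp add: clopen_in_def)
qed

lemma clopen_in_Un: "clopen_in X D \<Longrightarrow> clopen_in X E \<Longrightarrow> clopen_in X (D \<union> E)"
  using continuous_map_discrete_op[of "subtopology sequence_topology X" "\<lambda>y. y \<in> D" "\<lambda>y. y \<in> E" "(\<or>)"]
  by (auto simp: clopen_in_def)

lemma clopen_in_Diff: "clopen_in X D \<Longrightarrow> clopen_in X E \<Longrightarrow> clopen_in X (D - E)"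
  using continuous_map_discrete_op[of "subtopology sequence_topology X" "\<lambda>y. y \<in> D" "\<lambda>y. y \<in> E"
      "\<lambda>a b. a \<and> \<not> b"]
  by (auto simp: clopen_in_def)

lemma clopen_in_empty: "clopen_in X {}"
  by (simp add: clopen_in_def)

lemma clopen_in_UN:
  assumes "finite I" "\<And>i. i \<in> I \<Longrightarrow> clopen_in X (D i)"
  shows "clopen_in X (\<Union>i\<in>I. D i)"
  using assms by (induction I rule: finite_induct) (auto simp: clopen_in_empty clopen_in_Un)

lemma clopen_in_shift_preimage:
  assumes "subshift X" "clopen_in X D"
  shows "clopen_in X {y \<in> X. shift n y \<in> D}"
proof -
  have "continuous_map (subtopology sequence_topology X) (discrete_topology UNIV) (\<lambda>y. shift n y \<in> D)"
    using continuous_map_compose[OF continuous_map_shift_sub[OF assms(1), of n], of _ "\<lambda>y. y \<in> D"] assms(2)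
    by (simp add: clopen_in_def o_def)
  then have "continuous_map (subtopology sequence_topology X) (discrete_topology UNIV)
      (\<lambda>y. y \<in> {y \<in> X. shift n y \<in> D})"
    by (rule continuous_map_eq) simp
  then show ?thesis
    by (auto simp: clopen_in_def)
qed

lemma clopen_in_cylinder: "clopen_in X (cylinder X x R)"
proof -
  have compl: "clopen_in X (X - {y \<in> X. y i = x i})" for i
  proof -
    have "continuous_map (subtopology sequence_topology X) (discrete_topology UNIV) (\<lambda>y. y i)"
      unfolding sequence_topology_def
      by (intro continuous_map_from_subtopology continuous_map_product_projection) simp
    then have "continuous_map (subtopology sequence_topology X) (discrete_topology UNIV) (\<lambda>y. y i = x i)"
      by (rule continuous_map_compose[where g = "\<lambda>c. c = x i" and X'' = "discrete_topology UNIV", unfolded o_def]) simp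
    then have "clopen_in X {y \<in> X. y i = x i}"
      unfolding clopen_in_def by (auto elim: continuous_map_eq)
    then show ?thesis
      by (rule clopen_in_Diff[OF clopen_in_space])
  qed
  have "clopen_in X (X - (\<Union>i\<in>{- int R..int R}. X - {y \<in> X. y i = x i}))"
    by (rule clopen_in_Diff[OF clopen_in_space clopen_in_UN[OF finite_atLeastAtMost_int compl]])
  \<comment> \<open>The cylinder is a finite intersection, handled as the complement of a finite union.\<close>
  moreover have "X - (\<Union>i\<in>{- int R..int R}. X - {y \<in> X. y i = x i}) = cylinder X x R"
    by (auto simp: cylinder_def)
  ultimately show ?thesis
    by simp
qed

lemma eventually_constant_on_cylinder:
  assumes h: "continuous_map (subtopology sequence_topology X) (discrete_topology UNIV) h"
    and x: "x \<in> X"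
  shows "\<forall>\<^sub>F R in sequentially. \<forall>y\<in>cylinder X x R. h y = h x"
proof -
  have "openin (subtopology sequence_topology X) {y \<in> X. h y \<in> {h x}}"
    using h by (simp add: continuous_map_def del: insert_iff singleton_iff)
  then obtain U where U: "openin sequence_topology U" "{y \<in> X. h y = h x} = U \<inter> X"
    by (auto simp: openin_subtopology)
  then have "x \<in> U"
    using x by blast
  then obtain D where D: "finite {i. D i \<noteq> UNIV}" "x \<in> Pi\<^sub>E UNIV D" "Pi\<^sub>E UNIV D \<subseteq> U"
    using U(1) unfolding sequence_topology_def openin_product_topology_alt by force
  obtain r where r: "\<And>i. D i \<noteq> UNIV \<Longrightarrow> \<bar>i\<bar> \<le> r"
    using finite_imageI[OF D(1), of abs] unfolding finite_nat_set_iff_bounded_le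
    by (metis (mono_tags, lifting) D(1) Max_ge finite_imageI image_eqI mem_Collect_eq)
  have "h y = h x" if "nat r \<le> R" "y \<in> cylinder X x R" for R y
  proof -
    have "y i \<in> D i" for i
    proof (cases "D i = UNIV")
      case False
      then have "i \<in> {- int R..int R}"
        using r[OF False] that(1) by auto
      then have "y i = x i"
        using that(2) unfolding cylinder_def by blast
      with D(2) show ?thesis
        by auto
    qed simp
    then have "y \<in> U"
      using D(3) by auto
    then show ?thesis
      using U(2) that by (auto simp: cylinder_def)
  qed
  then show ?thesis
    unfolding eventually_sequentially by blast
qed

text \<open>
  Some \<open>t\<close> satisfies \<open>x (t + (j - i)) \<noteq> x t\<close>. If \<open>T\<^sup>i y\<close> and \<open>T\<^sup>j y\<close> both agree with \<open>x\<close> on a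
  window that contains \<open>t\<close> and \<open>t + (j - i)\<close>, then the entry of \<open>y\<close> at \<open>t + j\<close> would have to be both
  of these letters.
\<close>

lemma eventually_cylinder_translates_disjoint:
  assumes "\<not> periodic x" "i \<noteq> j"
  shows "\<forall>\<^sub>F R in sequentially. \<forall>y. \<not> (shift i y \<in> cylinder X x R \<and> shift j y \<in> cylinder X x R)"
proof -
  have *: "\<forall>\<^sub>F R in sequentially. \<forall>y. \<not> (shift i y \<in> cylinder X x R \<and> shift j y \<in> cylinder X x R)"
    if "i < j" for i j
  proof -
    have "shift (j - i) x \<noteq> x"
      using assms that by (auto simp: periodic_def)
    then obtain t where t: "x (t + (j - i)) \<noteq> x t"
      by (auto simp: shift_def fun_eq_iff)
    have False if "nat (\<bar>t\<bar> + (j - i)) \<le> R" "shift i y \<in> cylinder X x R" "shift j y \<in> cylinder X x R" for R y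
    proof -
      have bound: "t \<in> {- int R..int R}" "t + (j - i) \<in> {- int R..int R}"
        using that(1) \<open>i < j\<close> by auto
      have "shift i y (t + (j - i)) = x (t + (j - i))" "shift j y t = x t"
        using that(2,3) bound unfolding cylinder_def by blast+
      with t show False
        by (simp add: shift_def)
    qed
    then show ?thesis
      unfolding eventually_sequentially by blast
  qed
  show ?thesis
    using *[of i j] *[of j i] assms(2) by (cases "i < j") (auto elim: eventually_mono)
qed


section \<open>Indicators of bisections\<close>

text \<open>
  In crossed product notation, \<open>bisection n D\<close> is \<open>T\<^sup>n 1\<^sub>D\<close>, and \<open>1\<^sub>D T\<^sup>n = T\<^sup>n 1\<^sub>E\<close> with \<open>E\<close> the
  preimage of \<open>D\<close> under \<open>T\<^sup>n\<close>.
\<close>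

definition bisection :: "int \<Rightarrow> (int \<Rightarrow> 'a) set \<Rightarrow> int \<times> (int \<Rightarrow> 'a) \<Rightarrow> 'k::field" where
  "bisection n D = indicator ({n} \<times> D)"

lemma bisection_apply: "bisection n D (m, y) = (if m = n \<and> y \<in> D then 1 else 0)"
  by (simp add: bisection_def indicator_def)

lemma bisection_empty: "bisection n {} = 0"
  by (simp add: fun_eq_iff bisection_apply)

lemma bisection_in_algebra:
  assumes X: "subshift X" and D: "clopen_in X D"
  shows "bisection n D \<in> convolution_algebra X"
proof (rule convolution_algebraI[OF X, where N = "{n}"])
  fix m
  have "continuous_map (subtopology sequence_topology X) (discrete_topology UNIV) (\<lambda>y. y \<in> D)"
    using D by (simp add: clopen_in_def)
  then show "continuous_map (subtopology sequence_topology X) (discrete_topology UNIV) (\<lambda>y. bisection n D (m, y))"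
    unfolding bisection_apply
    by (rule continuous_map_compose[where g = "\<lambda>b. if m = n \<and> b then 1 else 0"
        and X'' = "discrete_topology UNIV", unfolded o_def]) simp
qed (use D in \<open>auto simp: bisection_apply clopen_in_def\<close>)

lemma bisection_convolution:
  assumes X: "subshift X" and y: "y \<in> X"
  shows "convolution X (bisection n D) f (m, y) = (if shift (m - n) y \<in> D then f (m - n, y) else 0)"
  by (subst convolution_eq_sum[OF X y, where N = "{n}"]) (auto simp: bisection_apply)

lemma bisection_convolution_bisection:
  assumes X: "subshift X" and E: "E \<subseteq> X"
  shows "convolution X (bisection n D) (bisection k E) = bisection (n + k) {y \<in> E. shift k y \<in> D}"
proof
  fix p :: "int \<times> (int \<Rightarrow> 'a)"
  obtain m y where p: "p = (m, y)"
    by (cases p)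
  show "convolution X (bisection n D) (bisection k E) p = bisection (n + k) {y \<in> E. shift k y \<in> D} p"
    using E by (cases "y \<in> X")
      (auto simp: p bisection_convolution[OF X] bisection_apply convolution_outside)
qed

text \<open>
  This is \<open>1\<^sub>C T\<^sup>i\<close>, the indicator function of the set of elements of degree \<open>i\<close> with range in \<open>C\<close>.
\<close>

definition tower_level :: "(int \<Rightarrow> 'a) set \<Rightarrow> (int \<Rightarrow> 'a) set \<Rightarrow> int \<Rightarrow> int \<times> (int \<Rightarrow> 'a) \<Rightarrow> 'k::field" where
  "tower_level X C i = bisection i {y \<in> X. shift i y \<in> C}"

text \<open>
  An element of \<open>G\<^sub>X\<close> of degree \<open>i + k\<close> with range \<open>y \<in> C\<close> factors uniquely as an element of degree \<open>i\<close>
  with range \<open>y\<close>, followed on the right by an element of degree \<open>k\<close>, whose source is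
  \<open>shift (- i - k) y\<close>. If \<open>f\<close> takes there a value that does not depend on \<open>y \<in> C\<close>, then multiplication
  by \<open>f\<close> maps level \<open>i\<close> of the tower to a combination of the levels \<open>i + k\<close>.
\<close>

lemma tower_level_convolution:
  assumes X: "subshift X" and F: "finite F" "\<forall>n y. n \<notin> F \<longrightarrow> f (n, y) = 0"
    and f: "f \<in> convolution_algebra X"
    and const: "\<And>k y. k \<in> F \<Longrightarrow> y \<in> C \<Longrightarrow> f (k, shift (- i - k) y) = f (k, shift (- i - k) x)"
  shows "convolution X (tower_level X C i) f \<in> module.span fun_scale (tower_level X C ` (+) i ` F)"
proof -
  interpret vector_space "fun_scale :: 'b \<Rightarrow> (int \<times> (int \<Rightarrow> 'a) \<Rightarrow> 'b) \<Rightarrow> _"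
    by (rule vector_space_fun_scale)
  have sum_apply: "(\<Sum>k\<in>F. g k) p = (\<Sum>k\<in>F. g k p)" for g :: "int \<Rightarrow> int \<times> (int \<Rightarrow> 'a) \<Rightarrow> 'b" and p
    using F(1) by (induction F) auto
  have "convolution X (tower_level X C i) f =
      (\<Sum>k\<in>F. fun_scale (f (k, shift (- i - k) x)) (tower_level X C (i + k)))"
  proof
    fix p :: "int \<times> (int \<Rightarrow> 'a)"
    obtain m y where p: "p = (m, y)"
      by (cases p)
    have "(\<Sum>k\<in>F. fun_scale (f (k, shift (- i - k) x)) (tower_level X C (i + k))) p =
        (\<Sum>k\<in>F. f (k, shift (- i - k) x) * tower_level X C (i + k) (m, y))"
      by (simp add: sum_apply fun_scale_def p)
    also have "\<dots> = (\<Sum>k\<in>F. if k = m - i then f (k, shift (- i - k) x) * tower_level X C m (m, y) else 0)"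
      by (intro sum.cong) (auto simp: tower_level_def bisection_apply)
    also have "\<dots> = (if m - i \<in> F then f (m - i, shift (- m) x) * tower_level X C m (m, y) else 0)"
      using F(1) by simp
    also have "\<dots> = convolution X (tower_level X C i) f p"
    proof (cases "y \<in> X")
      case True
      then show ?thesis
        using F(2) const[of "m - i" "shift m y"]
        by (auto simp: p tower_level_def bisection_convolution[OF X] bisection_apply shift_mem[OF X])
    qed (simp add: p convolution_outside tower_level_def bisection_apply)
    finally show "convolution X (tower_level X C i) f p =
        (\<Sum>k\<in>F. fun_scale (f (k, shift (- i - k) x)) (tower_level X C (i + k))) p" ..
  qed
  moreover have "\<dots> \<in> span (tower_level X C ` (+) i ` F)"
    by (intro span_sum span_scale span_base) auto
  ultimately show ?thesis
    by simp
qed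


section \<open>Almost invariant towers in modules\<close>

lemma act_bisection_bisection:
  fixes X :: "(int \<Rightarrow> 'a::finite) set"
    and scaleM :: "'k::field \<Rightarrow> 'm::ab_group_add \<Rightarrow> 'm"
  assumes X: "subshift X"
    and mod: "right_module fun_scale (convolution_algebra X :: (int \<times> (int \<Rightarrow> 'a) \<Rightarrow> 'k) set)
      (convolution X) (convolution_one X) scaleM M act"
    and u: "u \<in> M" and D: "clopen_in X D" and E: "clopen_in X E"
  shows "act (act u (bisection n D)) (bisection k E) =
    act u (bisection (n + k) {y \<in> E. shift k y \<in> D})"
  using right_module.act_mult[OF mod u bisection_in_algebra[OF X D] bisection_in_algebra[OF X E], of n k] E
  by (simp add: bisection_convolution_bisection[OF X] clopen_in_def)

text \<open>
  The cylinder \<open>C\<close> has to be chosen after the height \<open>n\<close> of the tower: the higher the tower, the smaller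
  \<open>C\<close> must be for its translates to be disjoint and for the given functions to be constant along
  them. The vector \<open>u\<close> depends on \<open>C\<close>, which is why the hypothesis quantifies over all cylinders.
\<close>

lemma exhaustively_amenable_of_cylinders:
  fixes X :: "(int \<Rightarrow> 'a::finite) set"
    and scaleM :: "'k::field \<Rightarrow> 'm::ab_group_add \<Rightarrow> 'm"
  assumes X: "subshift X" and x: "x \<in> X" "\<not> periodic x"
    and mod: "right_module fun_scale (convolution_algebra X :: (int \<times> (int \<Rightarrow> 'a) \<Rightarrow> 'k) set)
      (convolution X) (convolution_one X) scaleM M act"
    and nonzero: "\<And>R. \<exists>u\<in>M. act u (bisection 0 (cylinder X x R)) \<noteq> 0"
  shows "exhaustively_amenable fun_scale (convolution_algebra X) scaleM M act"
proof -
  interpret right_module fun_scale "convolution_algebra X :: (int \<times> (int \<Rightarrow> 'a) \<Rightarrow> 'k) set"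
      "convolution X" "convolution_one X" scaleM M act
    by (rule mod)
  show ?thesis
  proof (rule exhaustively_amenable_towers)
    fix B :: "(int \<times> (int \<Rightarrow> 'a) \<Rightarrow> 'k) set"
    assume B: "finite B" "B \<subseteq> convolution_algebra X"
    have "\<forall>f\<in>B. \<exists>N. finite N \<and> (\<forall>n x. n \<notin> N \<longrightarrow> f (n, x) = 0)"
      using B(2) finite_degreesE by (metis subsetD)
    then obtain N where N: "\<And>f. f \<in> B \<Longrightarrow> finite (N f)"
      "\<And>f n x. f \<in> B \<Longrightarrow> n \<notin> N f \<Longrightarrow> f (n, x) = 0"
      by metis
    obtain r where r: "\<And>f n. f \<in> B \<Longrightarrow> n \<in> N f \<Longrightarrow> \<bar>n\<bar> \<le> int r"
    proof -
      have "finite ((\<lambda>n. nat \<bar>n\<bar>) ` (\<Union>f\<in>B. N f))"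
        using B N by auto
      then obtain r where "\<forall>k\<in>(\<lambda>n. nat \<bar>n\<bar>) ` (\<Union>f\<in>B. N f). k \<le> r"
        unfolding finite_nat_set_iff_bounded_le by blast
      then show thesis
        by (intro that[of r]) fastforce
    qed
    let ?F = "{- int r..int r}"
    have F: "\<forall>n y. n \<notin> ?F \<longrightarrow> f (n, y) = 0" if "f \<in> B" for f
      using N(2)[OF that] r[OF that] by (metis abs_le_iff atLeastAtMost_iff minus_le_iff)
    \<comment> \<open>The levels can leave the tower by \<open>r\<close> steps at either end.\<close>
    show "\<exists>q. \<forall>n. \<exists>S P. S \<subseteq> M \<and> finite S \<and> M.independent S \<and>
      n \<le> card S \<and> finite P \<and> card P \<le> card S + q \<and> (\<forall>s\<in>S. \<forall>v\<in>B. act s v \<in> M.span P)"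
    proof (intro exI[of _ "2 * r"] allI)
      fix n
      let ?I = "{0..<int n}" and ?J = "{- int r..<int (n + r)}"
      have "\<forall>\<^sub>F R in sequentially. \<forall>f\<in>B. \<forall>i\<in>?I. \<forall>k\<in>?F. \<forall>y\<in>cylinder X x R.
          f (k, shift (- i - k) y) = f (k, shift (- i - k) x)"
      proof (intro ballI eventually_ball_finite[OF B(1)]
          eventually_ball_finite[OF finite_atLeastLessThan_int] eventually_ball_finite[OF finite_atLeastAtMost_int])
        fix f i k assume "f \<in> B"
        then have "continuous_map (subtopology sequence_topology X) (discrete_topology UNIV) (\<lambda>y. f (k, y))"
          using B(2) by (intro convolution_algebra_continuous) auto
        then have "continuous_map (subtopology sequence_topology X) (discrete_topology UNIV)
            (\<lambda>y. f (k, shift (- i - k) y))"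
          using continuous_map_compose[OF continuous_map_shift_sub[OF X]] by (fastforce simp: o_def)
        then show "\<forall>\<^sub>F R in sequentially. \<forall>y\<in>cylinder X x R.
            f (k, shift (- i - k) y) = f (k, shift (- i - k) x)"
          using x(1) by (rule eventually_constant_on_cylinder)
      qed
      moreover have "\<forall>\<^sub>F R in sequentially. \<forall>i\<in>?I. \<forall>j\<in>?I - {i}. \<forall>y.
          \<not> (shift i y \<in> cylinder X x R \<and> shift j y \<in> cylinder X x R)"
        by (intro ballI eventually_ball_finite[OF finite_atLeastLessThan_int]
            eventually_ball_finite[OF finite_Diff[OF finite_atLeastLessThan_int]]
            eventually_cylinder_translates_disjoint x(2)) auto
      ultimately have "\<exists>R. (\<forall>f\<in>B. \<forall>i\<in>?I. \<forall>k\<in>?F. \<forall>y\<in>cylinder X x R.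
            f (k, shift (- i - k) y) = f (k, shift (- i - k) x)) \<and>
          (\<forall>i\<in>?I. \<forall>j\<in>?I - {i}. \<forall>y. \<not> (shift i y \<in> cylinder X x R \<and> shift j y \<in> cylinder X x R))"
        by (intro eventually_happens'[OF sequentially_bot] eventually_conj) assumption+
      then obtain R where
          "\<forall>f\<in>B. \<forall>i\<in>?I. \<forall>k\<in>?F. \<forall>y\<in>cylinder X x R. f (k, shift (- i - k) y) = f (k, shift (- i - k) x)"
          "\<forall>i\<in>?I. \<forall>j\<in>?I - {i}. \<forall>y. \<not> (shift i y \<in> cylinder X x R \<and> shift j y \<in> cylinder X x R)"
        by (elim exE conjE)
      then have const: "\<And>f i k y. f \<in> B \<Longrightarrow> i \<in> ?I \<Longrightarrow> k \<in> ?F \<Longrightarrow> y \<in> cylinder X x R \<Longrightarrow>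
          f (k, shift (- i - k) y) = f (k, shift (- i - k) x)"
        and disj: "\<And>i j y. i \<in> ?I \<Longrightarrow> j \<in> ?I \<Longrightarrow> i \<noteq> j \<Longrightarrow>
          \<not> (shift i y \<in> cylinder X x R \<and> shift j y \<in> cylinder X x R)"
        by blast+
      define C where "C = cylinder X x R"
      let ?D = "\<lambda>i. {y \<in> X. shift i y \<in> C}"
      have C: "clopen_in X C"
        unfolding C_def by (rule clopen_in_cylinder)
      have CX: "C \<subseteq> X"
        by (auto simp: C_def cylinder_def)
      have bis: "bisection m E \<in> convolution_algebra X" if "clopen_in X E" for m E
        using that by (rule bisection_in_algebra[OF X])
      have D: "clopen_in X (?D i)" for i
        by (rule clopen_in_shift_preimage[OF X C])
      have tow: "tower_level X C i \<in> convolution_algebra X" for i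
        unfolding tower_level_def by (rule bis[OF D])
      obtain u where u: "u \<in> M" "act u (bisection 0 C) \<noteq> 0"
        using nonzero[of R] by (auto simp: C_def)
      define b where "b i = act u (tower_level X C i)" for i
      have bM: "b i \<in> M" for i
        by (simp add: b_def act_closed u tow)
      have b_bis: "act (b i) (bisection k E) = act u (bisection (i + k) {y \<in> E. shift k y \<in> ?D i})"
        if "clopen_in X E" for i k E
        unfolding b_def tower_level_def by (rule act_bisection_bisection[OF X mod u(1) D that])
      have b_sep: "act (b i) (bisection 0 (?D j)) = (if i = j then b i else 0)"
        if "i \<in> ?I" "j \<in> ?I" for i j
      proof -
        have "{y \<in> ?D j. shift 0 y \<in> ?D i} = (if i = j then ?D i else {})"
          using disj[OF that] by (auto simp: C_def)
        then have "act (b i) (bisection 0 (?D j)) = act u (bisection i (if i = j then ?D i else {}))"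
          by (simp only: b_bis[OF D] add_0_right)
        then show ?thesis
          by (simp add: b_def tower_level_def bisection_empty act_zero[OF u(1)])
      qed
      \<comment> \<open>Shifting the base of the tower up to level \<open>i\<close> is invertible: \<open>u 1\<^sub>C T\<^sup>i T\<^sup>-\<^sup>i = u 1\<^sub>C\<close>.\<close>
      have b_nz: "b i \<noteq> 0" for i
      proof
        assume "b i = 0"
        then have "act (b i) (bisection (- i) C) = 0"
          by (simp add: zero_act bis C)
        moreover have "{y \<in> C. shift (- i) y \<in> ?D i} = C"
          using CX by (auto simp: shift_mem[OF X])
        ultimately show False
          using u(2) by (simp add: b_bis[OF C])
      qed
      have inj: "inj_on b ?I" and ind: "M.independent (b ` ?I)"
        by (rule independent_of_separation[where p = "\<lambda>i. bisection 0 (?D i)" and b = b and I = ?I];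
            simp add: bM bis D b_sep b_nz)+
      have "act (b i) f \<in> M.span (b ` ?J)" if i: "i \<in> ?I" and f: "f \<in> B" for i f
      proof -
        have "convolution X (tower_level X C i) f \<in> A.span (tower_level X C ` (+) i ` ?F)"
        proof (rule tower_level_convolution[OF X _ F[OF f]])
          show "f (k, shift (- i - k) y) = f (k, shift (- i - k) x)" if "k \<in> ?F" "y \<in> C" for k y
            using const[OF f i] that by (simp add: C_def)
        qed (use f B in auto)
        also have "\<dots> \<subseteq> {a \<in> convolution_algebra X. act u a \<in> M.span (b ` ?J)}"
        proof (rule A.span_minimal)
          show "A.subspace {a \<in> convolution_algebra X. act u a \<in> M.span (b ` ?J)}"
            using u by (intro subspace_act_right_preimage) auto
          have "(+) i ` ?F \<subseteq> ?J"
            using i by auto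
          then show "tower_level X C ` (+) i ` ?F \<subseteq> {a \<in> convolution_algebra X. act u a \<in> M.span (b ` ?J)}"
            by (auto simp: tow simp flip: b_def intro!: M.span_base)
        qed
        finally show ?thesis
          using act_mult[OF u(1) tow[of i], of f] f B(2) by (auto simp: b_def)
      qed
      moreover have "card (b ` ?I) = n"
        using inj by (simp add: card_image)
      moreover have "card (b ` ?J) \<le> n + 2 * r"
        using card_image_le[of ?J b] by simp
      ultimately show "\<exists>S P. S \<subseteq> M \<and> finite S \<and> M.independent S \<and> n \<le> card S \<and> finite P \<and>
          card P \<le> card S + 2 * r \<and> (\<forall>s\<in>S. \<forall>v\<in>B. act s v \<in> M.span P)"
        using bM ind by (intro exI[of _ "b ` ?I"] exI[of _ "b ` ?J"]) auto
    qed
  qed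
qed


section \<open>Transitive and minimal subshifts\<close>

lemma finite_orbit_periodic:
  assumes "periodic x"
  shows "finite (orbit x)"
proof -
  obtain p where p: "p > 0" "shift p x = x"
    using assms by (auto simp: periodic_def)
  have x: "x (i + p) = x i" for i
    using fun_cong[OF p(2), of i] by (simp add: shift_def)
  have nat: "shift (int k * p) x = x" for k
  proof (induction k)
    case (Suc k)
    have "shift (int (Suc k) * p) x = shift (int k * p) (shift p x)"
      by (simp add: algebra_simps)
    with Suc p show ?case by simp
  qed simp
  have mult: "shift (k * p) x = x" for k
  proof (cases k rule: int_cases2)
    case (nonpos n)
    have "shift (- (int n * p)) (shift (int n * p) x) = x"
      by simp
    then show ?thesis
      by (simp add: nonpos nat)
  qed (simp add: nat)
  have "shift n x = shift (n mod p) x" for n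
  proof -
    have "shift n x = shift (n mod p) (shift (n div p * p) x)"
      by simp
    then show ?thesis
      by (simp add: mult)
  qed
  moreover have "n mod p \<in> {0..<p}" for n
    using p by simp
  ultimately have "orbit x \<subseteq> (\<lambda>n. shift n x) ` {0..<p}"
    unfolding orbit_def by blast
  then show ?thesis
    by (rule finite_subset) simp
qed

text \<open>
  A periodic point has a finite, hence closed orbit; if the orbit is also dense, it is the whole
  subshift.
\<close>

lemma transitive_aperiodic_nonperiodic_point:
  assumes "transitive_subshift X" "aperiodic_subshift X"
  obtains x where "x \<in> X" "\<not> periodic x"
proof -
  have X: "subshift X"
    using assms by (simp add: transitive_subshift_def)
  obtain x where x: "x \<in> X" "subtopology sequence_topology X closure_of orbit x = X"
    using assms by (auto simp: transitive_subshift_def)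
  have "\<not> periodic x"
  proof
    assume per: "periodic x"
    have "orbit x \<subseteq> X"
      using x shift_mem[OF X] by (auto simp: orbit_def)
    moreover have "Hausdorff_space (subtopology sequence_topology X)"
      unfolding sequence_topology_def
      by (intro Hausdorff_space_subtopology) (simp add: Hausdorff_space_product_topology)
    ultimately have "closedin (subtopology sequence_topology X) (orbit x)"
      using finite_orbit_periodic[OF per] by (intro closedin_Hausdorff_finite) auto
    then have "orbit x = X"
      using x(2) by (simp add: closure_of_closedin)
    with per assms(2) show False
      by (auto simp: aperiodic_subshift_def)
  qed
  with x that show thesis
    by blast
qed

text \<open>
  The points whose orbit avoids \<open>C\<close> form a closed invariant proper subset of \<open>X\<close>, which is empty by
  minimality; compactness then makes the cover finite.
\<close>

lemma minimal_finite_cover: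
  assumes min: "minimal_subshift X" and C: "clopen_in X C" "C \<noteq> {}"
  obtains N where "finite N" "X = (\<Union>n\<in>N. {y \<in> X. shift n y \<in> C})"
proof -
  let ?D = "\<lambda>n. {y \<in> X. shift n y \<in> C}"
  have X: "subshift X" and closed: "closedin sequence_topology X"
    using min by (auto simp: minimal_subshift_def subshift_def)
  have op: "openin (subtopology sequence_topology X) (?D n)" for n
    by (intro clopen_in_openin clopen_in_shift_preimage X C)
  have cover: "X = (\<Union>n. ?D n)"
  proof (rule ccontr)
    assume ne: "X \<noteq> (\<Union>n. ?D n)"
    define Y where "Y = X - (\<Union>n. ?D n)"
    have Y: "Y = {y \<in> X. \<forall>n. shift n y \<notin> C}"
      by (auto simp: Y_def)
    have "openin (subtopology sequence_topology X) (\<Union>n. ?D n)"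
      by (intro openin_Union) (use op in auto)
    then have "closedin (subtopology sequence_topology X) Y"
      unfolding Y_def
      using closedin_diff[OF closedin_topspace[of "subtopology sequence_topology X"]] by simp
    then have "closedin sequence_topology Y"
      using closed by (rule closedin_trans_full)
    moreover have "shift 1 ` Y = Y"
    proof -
      have inv: "shift n y \<in> Y" if "y \<in> Y" for n y
        using that by (auto simp: Y shift_mem[OF X])
      have "y \<in> shift 1 ` Y" if "y \<in> Y" for y
        using inv[OF that, of "- 1"] by (intro image_eqI[of _ _ "shift (- 1) y"]) auto
      with inv show ?thesis
        by blast
    qed
    moreover have "Y \<noteq> {}"
      using ne by (auto simp: Y_def)
    ultimately have "subshift Y"
      by (simp add: subshift_def)
    moreover have "Y \<subset> X"
    proof -
      obtain y where "y \<in> C" using C by blast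
      moreover have "y \<in> X" using C \<open>y \<in> C\<close> by (auto simp: clopen_in_def)
      moreover have "y \<notin> Y" using \<open>y \<in> C\<close> unfolding Y by (auto intro: exI[of _ 0])
      ultimately show ?thesis by (auto simp: Y)
    qed
    ultimately show False
      using min by (auto simp: minimal_subshift_def)
  qed
  have "compact_space (sequence_topology :: (int \<Rightarrow> 'a) topology)"
    by (simp add: sequence_topology_def compact_space_product_topology compact_space_discrete_topology)
  then have "compactin (subtopology sequence_topology X) X"
    using closed by (simp add: closedin_compact_space compactin_subtopology)
  then obtain \<F> where fin: "finite \<F>" "\<F> \<subseteq> range ?D" and \<F>: "X \<subseteq> \<Union>\<F>"
    using op cover compactinD[of "subtopology sequence_topology X" X "range ?D"] by blast
  obtain N where N: "finite N" "\<F> = ?D ` N"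
    using finite_subset_image[OF fin] by blast
  show thesis
  proof (rule that[OF N(1)])
    show "X = (\<Union>n\<in>N. ?D n)"
      using \<F> unfolding N(2) by blast
  qed
qed

text \<open>
  The annihilator of \<open>M\<close> is a two-sided ideal. If it contains \<open>1\<^sub>C\<close>, then it contains the indicator
  function \<open>T\<^sup>-\<^sup>n 1\<^sub>C T\<^sup>n\<close> of every translate of \<open>C\<close>, then those of finite unions of translates, and so
  \<open>1\<close>.
\<close>

lemma minimal_cylinder_acts_nonzero:
  fixes X :: "(int \<Rightarrow> 'a::finite) set"
    and scaleM :: "'k::field \<Rightarrow> 'm::ab_group_add \<Rightarrow> 'm"
  assumes min: "minimal_subshift X" and C: "clopen_in X C" "C \<noteq> {}"
    and mod: "right_module fun_scale (convolution_algebra X :: (int \<times> (int \<Rightarrow> 'a) \<Rightarrow> 'k) set)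
      (convolution X) (convolution_one X) scaleM M act"
    and M: "M \<noteq> {0}"
  shows "\<exists>u\<in>M. act u (bisection 0 C) \<noteq> 0"
proof (rule ccontr)
  assume "\<not> ?thesis"
  then have zero: "act u (bisection 0 C) = 0" if "u \<in> M" for u
    using that by blast
  interpret right_module fun_scale "convolution_algebra X :: (int \<times> (int \<Rightarrow> 'a) \<Rightarrow> 'k) set"
      "convolution X" "convolution_one X" scaleM M act
    by (rule mod)
  let ?D = "\<lambda>n. {y \<in> X. shift n y \<in> C}"
  have X: "subshift X"
    using min by (simp add: minimal_subshift_def)
  have CX: "C \<subseteq> X"
    using C by (simp add: clopen_in_def)
  have D: "clopen_in X (?D n)" for n
    by (intro clopen_in_shift_preimage X C)
  have bis: "bisection m E \<in> convolution_algebra X" if "clopen_in X E" for m E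
    using that by (rule bisection_in_algebra[OF X])
  note prod = act_bisection_bisection[OF X mod]
  have zero_D: "act u (bisection 0 (?D n)) = 0" if u: "u \<in> M" for u n
  proof -
    have "act u (bisection 0 (?D n)) = act (act u (bisection (- n) C)) (bisection n X)"
      by (simp add: prod u C clopen_in_space)
    also have "act u (bisection (- n) C) = act (act u (bisection (- n) X)) (bisection 0 C)"
    proof -
      have "{y \<in> C. shift 0 y \<in> X} = C"
        using CX by auto
      then show ?thesis
        by (simp add: prod u C clopen_in_space del: shift_0)
    qed
    also have "\<dots> = 0"
      by (intro zero act_closed u bis clopen_in_space)
    finally show ?thesis
      by (simp add: zero_act bis clopen_in_space)
  qed
  have zero_UN: "act u (bisection 0 (\<Union>n\<in>N. ?D n)) = 0" if "finite N" "u \<in> M" for u N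
    using that
  proof (induction N)
    case empty
    then show ?case
      by (simp add: bisection_empty act_zero del: zero_fun_apply)
  next
    case (insert n N)
    let ?U = "\<Union>n\<in>N. ?D n"
    have U: "clopen_in X ?U"
      using insert D by (intro clopen_in_UN) auto
    have "(bisection 0 (\<Union>n\<in>insert n N. ?D n) :: int \<times> (int \<Rightarrow> 'a) \<Rightarrow> 'k) =
        bisection 0 (?D n - ?U) + bisection 0 ?U"
      by (auto simp: fun_eq_iff bisection_apply)
    then have "act u (bisection 0 (\<Union>n\<in>insert n N. ?D n)) =
        act u (bisection 0 (?D n - ?U)) + act u (bisection 0 ?U)"
      using insert by (simp only: act_add_right bis clopen_in_Diff D U)
    also have "act u (bisection 0 (?D n - ?U)) = act (act u (bisection 0 (?D n))) (bisection 0 (?D n - ?U))"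
    proof -
      have "{y \<in> ?D n - ?U. shift 0 y \<in> ?D n} = ?D n - ?U"
        by auto
      then show ?thesis
        using insert by (simp add: prod D U clopen_in_Diff del: shift_0)
    qed
    finally show ?case
      using insert by (simp add: zero_D zero_act bis clopen_in_Diff D U)
  qed
  obtain N where N: "finite N" "X = (\<Union>n\<in>N. ?D n)"
    using minimal_finite_cover[OF min C] .
  have one: "convolution_one X = (bisection 0 X :: int \<times> (int \<Rightarrow> 'a) \<Rightarrow> 'k)"
    by (auto simp: convolution_one_def bisection_def indicator_def)
  have "m = 0" if "m \<in> M" for m
    using zero_UN[OF N(1) that] act_one[OF that] by (simp only: one flip: N(2))
  then show False
    using M M.subspace_0[OF subspace_module] by auto
qed

theorem theorem1p2:
  fixes X :: "(int \<Rightarrow> 'a::finite) set"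
  assumes "transitive_subshift X"
    and "aperiodic_subshift X"
    and "exhaustively_amenable
      fun_scale (monomial_algebra X :: ('a list \<Rightarrow> 'k::field) set)
      fun_scale (monomial_algebra X) (monomial_mult X)"
  shows "exhaustively_amenable
      fun_scale (convolution_algebra X :: (int \<times> (int \<Rightarrow> 'a) \<Rightarrow> 'k) set)
      fun_scale (convolution_algebra X) (convolution X) \<and>
    (minimal_subshift X \<longrightarrow>
      (\<forall>(scaleM :: 'k \<Rightarrow> 'm::ab_group_add \<Rightarrow> 'm) M act.
        right_module fun_scale (convolution_algebra X) (convolution X) (convolution_one X)
          scaleM M act \<and> M \<noteq> {0} \<longrightarrow>
        exhaustively_amenable
          fun_scale (convolution_algebra X :: (int \<times> (int \<Rightarrow> 'a) \<Rightarrow> 'k) set) scaleM M act))"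
proof -
  have X: "subshift X"
    using assms(1) by (simp add: transitive_subshift_def)
  obtain x where x: "x \<in> X" "\<not> periodic x"
    using transitive_aperiodic_nonperiodic_point[OF assms(1,2)] .
  have x_cyl: "x \<in> cylinder X x R" for R
    using x by (simp add: cylinder_def)
  interpret K_algebra fun_scale "convolution_algebra X :: (int \<times> (int \<Rightarrow> 'a) \<Rightarrow> 'k) set"
      "convolution X" "convolution_one X"
    by (rule K_algebra_convolution_algebra[OF X])
  have regular: "exhaustively_amenable
      fun_scale (convolution_algebra X :: (int \<times> (int \<Rightarrow> 'a) \<Rightarrow> 'k) set)
      fun_scale (convolution_algebra X) (convolution X)"
  proof (rule exhaustively_amenable_of_cylinders[OF X x right_module_self])
    fix R
    have "(bisection 0 (cylinder X x R) :: int \<times> (int \<Rightarrow> 'a) \<Rightarrow> 'k) \<in> convolution_algebra X"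
      by (rule bisection_in_algebra[OF X clopen_in_cylinder])
    then have "convolution X (convolution_one X) (bisection 0 (cylinder X x R)) (0, x) = (1 :: 'k)"
      using x_cyl by (simp add: mult_one_left bisection_apply)
    then have "convolution X (convolution_one X) (bisection 0 (cylinder X x R)) \<noteq>
        (0 :: int \<times> (int \<Rightarrow> 'a) \<Rightarrow> 'k)"
      by auto
    then show "\<exists>u\<in>convolution_algebra X. convolution X u (bisection 0 (cylinder X x R)) \<noteq>
        (0 :: int \<times> (int \<Rightarrow> 'a) \<Rightarrow> 'k)"
      using one_closed by (rule bexI)
  qed
  have modules: "exhaustively_amenable
      fun_scale (convolution_algebra X :: (int \<times> (int \<Rightarrow> 'a) \<Rightarrow> 'k) set) scaleM M act"
    if min: "minimal_subshift X"
      and mod: "right_module fun_scale (convolution_algebra X) (convolution X) (convolution_one X)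
        scaleM M act"
      and M: "M \<noteq> {0}"
    for scaleM :: "'k \<Rightarrow> 'm \<Rightarrow> 'm" and M act
  proof (rule exhaustively_amenable_of_cylinders[OF X x mod])
    show "\<exists>u\<in>M. act u (bisection 0 (cylinder X x R)) \<noteq> 0" for R
      using x_cyl by (intro minimal_cylinder_acts_nonzero[OF min clopen_in_cylinder _ mod M]) auto
  qed
  show ?thesis
  proof (rule conjI[OF regular], rule impI, (rule allI)+, rule impI, erule conjE)
    fix scaleM :: "'k \<Rightarrow> 'm \<Rightarrow> 'm" and M act
    assume "minimal_subshift X" and "M \<noteq> {0}"
      and "right_module fun_scale (convolution_algebra X :: (int \<times> (int \<Rightarrow> 'a) \<Rightarrow> 'k) set)
        (convolution X) (convolution_one X) scaleM M act"
    then show "exhaustively_amenable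
        fun_scale (convolution_algebra X :: (int \<times> (int \<Rightarrow> 'a) \<Rightarrow> 'k) set) scaleM M act"
      by (intro modules)
  qed
qed

end
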